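(* There exist an integer $N\ge 2$, a dimension $d\ge 1$, functions $f_1,\dots,f_N:\mathbb{R}^d\to\mathbb{R}$ with average $f=\frac1N\sum_{i=1}^N f_i$, a stochastic gradient oracle and a mixing matrix $W$ satisfying Assumptions (A1)--(A4) of the context, together with an initialization and hyperparameters, such that the iterates of the DADAM algorithm (defined in the context) fail to converge to a stationary point of $f$; that is, with $\overline X_t=\frac1N\sum_{i=1}^N x_{t,i}$, the sequence $\nabla f(\overline X_t)$ does not converge to $0$ as $t\to\infty$.
   Context: Assumptions. (A1) Each $f_i$ is differentiable and $\|\nabla f_i(x)-\nabla f_i(y)\|\le L\|x-y\|$ for all $x,y\in\mathbb{R}^d$. (A2) At iteration $t$ node $i$ accesses a stochastic gradient $g_{t,i}$; $\|g_{t,i}\|_\infty\le G_\infty$ and $\|\nabla f_i(x)\|_\infty\le G_\infty$ for all $t,i,x$. (A3) $\mathbb{E}[g_{t,i}]=\nabla f_i(x_{t,i})$ (expectation conditional on the past) and $\mathbb{E}[([g_{t,i}-\nabla f_i(x_{t,i})]_j)^2]\le\sigma^2$ for all $t,i,j$ (exact gradients are allowed). (A4) The $N\times N$ matrix $W$ is symmetric with $W_{ij}\ge 0$, all row sums and column sums equal to $1$, and eigenvalues $1=\lambda_1\ge\lambda_2\ge\dots\ge\lambda_N$ with $|\lambda_2|<1$, $|\lambda_N|<1$; moreover $W_{ij}=0$ if $i$ and $j$ are not neighbors in the communication graph. DADAM. Hyperparameters: step size $\alpha>0$, $\beta_1,\beta_2,\beta_3\in[0,1)$, $\epsilon>0$.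 Initialization: points $x_{1,i}\in\mathbb{R}^d$, $\hat v_{0,i}=\epsilon\mathbf 1$, $v_{0,i}=0$, $m_{0,i}=0$. For $t=1,2,\dots$ and every node $i$ (all vector operations, i.e. squares, square roots, maxima and quotients, are coordinatewise): $m_{t,i}=\beta_1m_{t-1,i}+(1-\beta_1)g_{t,i}$; $v_{t,i}=\beta_2v_{t-1,i}+(1-\beta_2)g_{t,i}^2$; $\hat v_{t,i}=\beta_3\hat v_{t-1,i}+(1-\beta_3)\max(\hat v_{t-1,i},v_{t,i})$; $x_{t+1,i}=\sum_{j=1}^NW_{ij}x_{t,j}-\alpha\, m_{t,i}/\sqrt{\hat v_{t,i}}$. *)

theory Defs
  imports "HOL-Probability.Probability" "Jordan_Normal_Form.Char_Poly"
begin

no_notation vec_nth (infixl "$" 90)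
no_notation inner (infix "\<bullet>" 70)

text \<open>
  The dimension and the number of nodes are bound by quantifiers, so points of Euclidean
  \<open>d\<close>-space are the elements of \<open>carrier_vec d\<close>, and nodes and coordinates are numbered from 0.
  The type \<open>real vec\<close> carries no norm in the libraries, whence the explicit Euclidean norm, sup norm
  and Frechet derivative.
\<close>

definition norm2 :: "real vec \<Rightarrow> real" where
  "norm2 v = sqrt (v \<bullet> v)"

text \<open>Only meaningful for vectors of positive dimension.\<close>

definition norm_inf :: "real vec \<Rightarrow> real" where
  "norm_inf v = (MAX k\<in>{..<dim_vec v}. \<bar>v $ k\<bar>)"

definition has_gradient :: "nat \<Rightarrow> (real vec \<Rightarrow> real) \<Rightarrow> real vec \<Rightarrow> real vec \<Rightarrow> bool" where
  "has_gradient d f v x \<longleftrightarrow> v \<in> carrier_vec d \<and>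
     (\<forall>e>0. \<exists>\<delta>>0. \<forall>y\<in>carrier_vec d. norm2 (y - x) < \<delta> \<longrightarrow>
        \<bar>f y - f x - v \<bullet> (y - x)\<bar> \<le> e * norm2 (y - x))"

text \<open>Arbitrary at points where the function is not differentiable.\<close>

definition gradient :: "nat \<Rightarrow> (real vec \<Rightarrow> real) \<Rightarrow> real vec \<Rightarrow> real vec" where
  "gradient d f x = (THE v. has_gradient d f v x)"

definition average_objective :: "nat \<Rightarrow> (nat \<Rightarrow> real vec \<Rightarrow> real) \<Rightarrow> real vec \<Rightarrow> real" where
  "average_objective N f x = (\<Sum>i<N. f i x) / real N"

definition average_point :: "nat \<Rightarrow> nat \<Rightarrow> (nat \<Rightarrow> real vec) \<Rightarrow> real vec" where
  "average_point N d x = vec d (\<lambda>k. (\<Sum>i<N. x i $ k) / real N)"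


section \<open>The algorithm\<close>

text \<open>
  The iteration is defined along one realisation \<open>g\<close> of the stochastic gradients: \<open>g t i\<close> is the
  gradient seen by node \<open>i\<close> at iteration \<open>t = 1, 2, \<dots>\<close>.  The value of \<open>g\<close> at iteration 0 is never used.
\<close>

fun dadam_m :: "nat \<Rightarrow> real \<Rightarrow> (nat \<Rightarrow> nat \<Rightarrow> real vec) \<Rightarrow> nat \<Rightarrow> nat \<Rightarrow> real vec" where
  "dadam_m d \<beta>1 g 0 i = 0\<^sub>v d"
| "dadam_m d \<beta>1 g (Suc t) i =
     vec d (\<lambda>k. \<beta>1 * dadam_m d \<beta>1 g t i $ k + (1 - \<beta>1) * g (Suc t) i $ k)"

fun dadam_v :: "nat \<Rightarrow> real \<Rightarrow> (nat \<Rightarrow> nat \<Rightarrow> real vec) \<Rightarrow> nat \<Rightarrow> nat \<Rightarrow> real vec" where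
  "dadam_v d \<beta>2 g 0 i = 0\<^sub>v d"
| "dadam_v d \<beta>2 g (Suc t) i =
     vec d (\<lambda>k. \<beta>2 * dadam_v d \<beta>2 g t i $ k + (1 - \<beta>2) * (g (Suc t) i $ k)\<^sup>2)"

fun dadam_vhat ::
  "nat \<Rightarrow> real \<Rightarrow> real \<Rightarrow> real \<Rightarrow> (nat \<Rightarrow> nat \<Rightarrow> real vec) \<Rightarrow> nat \<Rightarrow> nat \<Rightarrow> real vec" where
  "dadam_vhat d \<beta>2 \<beta>3 \<epsilon> g 0 i = vec d (\<lambda>k. \<epsilon>)"
| "dadam_vhat d \<beta>2 \<beta>3 \<epsilon> g (Suc t) i =
     vec d (\<lambda>k. \<beta>3 * dadam_vhat d \<beta>2 \<beta>3 \<epsilon> g t i $ k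
       + (1 - \<beta>3) * max (dadam_vhat d \<beta>2 \<beta>3 \<epsilon> g t i $ k) (dadam_v d \<beta>2 g (Suc t) i $ k))"

text \<open>
  The points are numbered from \<open>t = 1\<close>, with initial points \<open>x1 i\<close>; the value at \<open>t = 0\<close> is a dummy.
\<close>

fun dadam_x ::
  "nat \<Rightarrow> nat \<Rightarrow> real mat \<Rightarrow> real \<Rightarrow> real \<Rightarrow> real \<Rightarrow> real \<Rightarrow> real \<Rightarrow> (nat \<Rightarrow> real vec) \<Rightarrow>
   (nat \<Rightarrow> nat \<Rightarrow> real vec) \<Rightarrow> nat \<Rightarrow> nat \<Rightarrow> real vec" where
  "dadam_x N d W \<alpha> \<beta>1 \<beta>2 \<beta>3 \<epsilon> x1 g 0 i = x1 i"
| "dadam_x N d W \<alpha> \<beta>1 \<beta>2 \<beta>3 \<epsilon> x1 g (Suc 0) i = x1 i"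
| "dadam_x N d W \<alpha> \<beta>1 \<beta>2 \<beta>3 \<epsilon> x1 g (Suc (Suc t)) i =
     vec d (\<lambda>k. (\<Sum>j<N. W $$ (i, j) * dadam_x N d W \<alpha> \<beta>1 \<beta>2 \<beta>3 \<epsilon> x1 g (Suc t) j $ k)
       - \<alpha> * dadam_m d \<beta>1 g (Suc t) i $ k / sqrt (dadam_vhat d \<beta>2 \<beta>3 \<epsilon> g (Suc t) i $ k))"


section \<open>The assumptions\<close>

definition smooth_objectives :: "nat \<Rightarrow> nat \<Rightarrow> (nat \<Rightarrow> real vec \<Rightarrow> real) \<Rightarrow> real \<Rightarrow> bool" where
  "smooth_objectives N d f L \<longleftrightarrow>
     (\<forall>i<N. (\<forall>x\<in>carrier_vec d. \<exists>v. has_gradient d (f i) v x) \<and>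
        (\<forall>x\<in>carrier_vec d. \<forall>y\<in>carrier_vec d.
           norm2 (gradient d (f i) x - gradient d (f i) y) \<le> L * norm2 (x - y)))"

text \<open>The oracle is a family of random vectors \<open>g t i\<close> on a probability space \<open>M\<close>.\<close>

definition gradient_oracle ::
  "nat \<Rightarrow> nat \<Rightarrow> 'w measure \<Rightarrow> (nat \<Rightarrow> nat \<Rightarrow> 'w \<Rightarrow> real vec) \<Rightarrow> bool" where
  "gradient_oracle N d M g \<longleftrightarrow> prob_space M \<and>
     (\<forall>t\<ge>1. \<forall>i<N. (\<forall>\<omega>\<in>space M. g t i \<omega> \<in> carrier_vec d) \<and>
        (\<forall>k<d. (\<lambda>\<omega>. g t i \<omega> $ k) \<in> borel_measurable M))"

definition bounded_gradients ::
  "nat \<Rightarrow> nat \<Rightarrow> (nat \<Rightarrow> real vec \<Rightarrow> real) \<Rightarrow> 'w measure \<Rightarrow> (nat \<Rightarrow> nat \<Rightarrow> 'w \<Rightarrow> real vec) \<Rightarrow>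
   real \<Rightarrow> bool" where
  "bounded_gradients N d f M g G \<longleftrightarrow>
     (\<forall>t\<ge>1. \<forall>i<N. \<forall>\<omega>\<in>space M. norm_inf (g t i \<omega>) \<le> G) \<and>
     (\<forall>i<N. \<forall>x\<in>carrier_vec d. norm_inf (gradient d (f i) x) \<le> G)"

text \<open>
  The sigma-algebra of the past of iteration \<open>t\<close>: everything all nodes have sampled strictly before
  \<open>t\<close>.  The initial points being deterministic, the points of iteration \<open>t\<close> are measurable for it.
\<close>

definition past ::
  "nat \<Rightarrow> nat \<Rightarrow> 'w measure \<Rightarrow> (nat \<Rightarrow> nat \<Rightarrow> 'w \<Rightarrow> real vec) \<Rightarrow> nat \<Rightarrow> 'w measure" where
  "past N d M g t = sigma (space M)
     {(\<lambda>\<omega>. g s i \<omega> $ k) -` B \<inter> space M | s i k B.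
        1 \<le> s \<and> s < t \<and> i < N \<and> k < d \<and> B \<in> sets borel}"

text \<open>
  \<open>x t i \<omega>\<close> is the point of node \<open>i\<close> at iteration \<open>t\<close>.  The second moment is conditional as well;
  this implies the bound on the unconditional one.
\<close>

definition unbiased_bounded_variance ::
  "nat \<Rightarrow> nat \<Rightarrow> (nat \<Rightarrow> real vec \<Rightarrow> real) \<Rightarrow> 'w measure \<Rightarrow> (nat \<Rightarrow> nat \<Rightarrow> 'w \<Rightarrow> real vec) \<Rightarrow>
   (nat \<Rightarrow> nat \<Rightarrow> 'w \<Rightarrow> real vec) \<Rightarrow> real \<Rightarrow> bool" where
  "unbiased_bounded_variance N d f M g x \<sigma> \<longleftrightarrow>
     (\<forall>t\<ge>1. \<forall>i<N. \<forall>k<d.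
        (AE \<omega> in M. real_cond_exp M (past N d M g t) (\<lambda>\<omega>. g t i \<omega> $ k) \<omega>
           = gradient d (f i) (x t i \<omega>) $ k) \<and>
        (AE \<omega> in M. real_cond_exp M (past N d M g t)
           (\<lambda>\<omega>. ((g t i \<omega> - gradient d (f i) (x t i \<omega>)) $ k)\<^sup>2) \<omega> \<le> \<sigma>\<^sup>2))"

text \<open>Edges of a simple graph on the nodes, as two-element sets.\<close>

definition communication_graph :: "nat \<Rightarrow> nat set set \<Rightarrow> bool" where
  "communication_graph N E \<longleftrightarrow> (\<forall>e\<in>E. e \<subseteq> {..<N} \<and> card e = 2)"

text \<open>
  The list \<open>ls\<close> is the spectrum with multiplicities in decreasing order, so \<open>\<lambda>\<^sub>r\<close> is \<open>ls ! (r - 1)\<close>.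
  Every node may mix in its own point, hence the diagonal of \<open>W\<close> is not constrained by the graph.
\<close>

definition mixing_matrix :: "nat \<Rightarrow> nat set set \<Rightarrow> real mat \<Rightarrow> bool" where
  "mixing_matrix N E W \<longleftrightarrow> W \<in> carrier_mat N N \<and> W\<^sup>T = W \<and>
     (\<forall>i<N. \<forall>j<N. 0 \<le> W $$ (i, j)) \<and>
     (\<forall>i<N. (\<Sum>j<N. W $$ (i, j)) = 1) \<and>
     (\<forall>j<N. (\<Sum>i<N. W $$ (i, j)) = 1) \<and>
     (\<exists>ls. char_poly W = (\<Prod>l\<leftarrow>ls. [:- l, 1:]) \<and> length ls = N \<and> sorted_wrt (\<ge>) ls \<and>
        ls ! 0 = 1 \<and> \<bar>ls ! 1\<bar> < 1 \<and> \<bar>ls ! (N - 1)\<bar> < 1) \<and>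
     (\<forall>i<N. \<forall>j<N. i \<noteq> j \<longrightarrow> {i, j} \<notin> E \<longrightarrow> W $$ (i, j) = 0)"

end

(* Two nodes with f_i(x) = c_i sqrt(1 + (x - a_i)^2) on the line, where c = (1, 3) and a = (2, -2),
   are run with exact gradients. Without momentum and averaging, each node steps by the sign of its
   own gradient, which forgets the weights c_i. Started at 1 and -1, both nodes average to 0 and then
   step back to where they were, so they never move. But 0 is not stationary for f, precisely because
   the weights differ: f'(0) = (c_2 - c_1) / sqrt 5. As f is coercive, it does have stationary points. *)
theory Submission
  imports Defs
begin

section \<open>Calculus on the line, phrased for vectors of dimension 1\<close>

lemma vec_1_eq: "x \<in> carrier_vec 1 \<Longrightarrow> x = vec 1 (\<lambda>_. x $ 0)"
  by (intro eq_vecI) auto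

lemma norm2_dim1: "v \<in> carrier_vec 1 \<Longrightarrow> norm2 v = \<bar>v $ 0\<bar>"
proof -
  assume "v \<in> carrier_vec 1"
  then have "v \<bullet> v = v $ 0 * v $ 0"
    by (simp add: scalar_prod_def)
  then show ?thesis
    unfolding norm2_def by (simp only: real_sqrt_abs2)
qed

lemma norm_inf_dim1: "v \<in> carrier_vec 1 \<Longrightarrow> norm_inf v = \<bar>v $ 0\<bar>"
  by (simp add: norm_inf_def lessThan_Suc)

text \<open>In dimension 1 the Euclidean norm is the absolute value and the scalar product is
  multiplication, so the epsilon-delta condition becomes the usual one for
  \<open>has_derivative\<close>. Real differentiation rules thereby apply to
  \<open>has_gradient\<close>.\<close>

lemma has_gradient_dim1_iff:
  assumes x: "x \<in> carrier_vec 1"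
  shows "has_gradient 1 (\<lambda>y. F (y $ 0)) v x \<longleftrightarrow>
    v \<in> carrier_vec 1 \<and> (F has_real_derivative v $ 0) (at (x $ 0))"
proof -
  have "(\<forall>y\<in>carrier_vec 1. norm2 (y - x) < \<delta> \<longrightarrow>
      \<bar>F (y $ 0) - F (x $ 0) - v \<bullet> (y - x)\<bar> \<le> e * norm2 (y - x)) \<longleftrightarrow>
    (\<forall>s. \<bar>s - x $ 0\<bar> < \<delta> \<longrightarrow>
      \<bar>F s - F (x $ 0) - v $ 0 * (s - x $ 0)\<bar> \<le> e * \<bar>s - x $ 0\<bar>)" (is "?A \<longleftrightarrow> ?B")
    if v: "v \<in> carrier_vec 1" for e \<delta> :: real
  proof
    assume A: ?A
    show ?B
    proof (intro allI)
      fix s :: real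
      show "\<bar>s - x $ 0\<bar> < \<delta> \<longrightarrow>
        \<bar>F s - F (x $ 0) - v $ 0 * (s - x $ 0)\<bar> \<le> e * \<bar>s - x $ 0\<bar>"
        using A[rule_format, of "vec 1 (\<lambda>_. s)"] x v by (simp add: norm2_dim1 scalar_prod_def)
    qed
  next
    assume B: ?B
    show ?A
      using B x v by (auto simp: norm2_dim1 scalar_prod_def)
  qed
  then show ?thesis
    unfolding has_gradient_def has_field_derivative_def has_derivative_at_alt
    by (auto simp: bounded_linear_mult_right)
qed

text \<open>Uniqueness of the real derivative makes the description in \<open>gradient\<close>
  denote it.\<close>

lemma gradient_dim1:
  assumes "x \<in> carrier_vec 1" "(F has_real_derivative D) (at (x $ 0))"
  shows "gradient 1 (\<lambda>y. F (y $ 0)) x = vec 1 (\<lambda>_. D)"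
  unfolding gradient_def
proof (rule the_equality)
  show "has_gradient 1 (\<lambda>y. F (y $ 0)) (vec 1 (\<lambda>_. D)) x"
    using assms by (simp add: has_gradient_dim1_iff del: One_nat_def)
  fix v assume "has_gradient 1 (\<lambda>y. F (y $ 0)) v x"
  then have "v \<in> carrier_vec 1" "v $ 0 = D"
    using assms by (auto simp: has_gradient_dim1_iff simp del: One_nat_def intro: DERIV_unique)
  then show "v = vec 1 (\<lambda>_. D)"
    using vec_1_eq by metis
qed

section \<open>The function \<open>sqrt (1 + u\<^sup>2)\<close> and its derivative
  \<open>bend\<close>\<close>

definition bend :: "real \<Rightarrow> real" where
  "bend u = u / sqrt (1 + u\<^sup>2)"

lemma sqrt_one_plus_square_pos: "0 < sqrt (1 + (u::real)\<^sup>2)"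
  by (simp add: add_pos_nonneg)

lemma DERIV_sqrt_one_plus_square:
  "((\<lambda>s. c * sqrt (1 + (s - a)\<^sup>2)) has_real_derivative c * bend (s - a)) (at s)"
proof -
  have "0 < 1 + (s - a)\<^sup>2"
    using sqrt_one_plus_square_pos[of "s - a"] by simp
  moreover have "((\<lambda>s. 1 + (s - a)\<^sup>2) has_real_derivative 2 * (s - a)) (at s)"
    by (auto intro!: derivative_eq_intros)
  ultimately have "((\<lambda>s. sqrt (1 + (s - a)\<^sup>2)) has_real_derivative
      inverse (sqrt (1 + (s - a)\<^sup>2)) / 2 * (2 * (s - a))) (at s)"
    by (rule DERIV_chain2[OF DERIV_real_sqrt])
  also have "inverse r / 2 * (2 * u) = u / r" for r u :: real
    by (simp add: divide_simps)
  finally have "((\<lambda>s. sqrt (1 + (s - a)\<^sup>2)) has_real_derivative bend (s - a)) (at s)"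
    unfolding bend_def .
  then show ?thesis by (rule DERIV_cmult)
qed

text \<open>This bound is the reason for square roots in the objectives: quadratic ones would have
  unbounded gradients.\<close>

lemma abs_bend_le: "\<bar>bend u\<bar> \<le> 1"
proof -
  have "\<bar>u\<bar> \<le> sqrt (1 + u\<^sup>2)"
    by (rule real_le_rsqrt) simp
  then show ?thesis
    using sqrt_one_plus_square_pos[of u] by (simp add: bend_def)
qed

text \<open>The derivative of \<open>bend\<close> is the inverse cube of
  \<open>sqrt (1 + s\<^sup>2)\<close>, which lies between 0 and 1; the mean value inequality
  concludes.\<close>

lemma bend_Lipschitz: "\<bar>bend u - bend v\<bar> \<le> \<bar>u - v\<bar>"
proof -
  have deriv: "(bend has_real_derivative 1 / sqrt (1 + s\<^sup>2) ^ 3) (at s)" for s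
  proof -
    let ?r = "sqrt (1 + s\<^sup>2)"
    have r: "?r > 0" "?r\<^sup>2 = 1 + s\<^sup>2"
      using sqrt_one_plus_square_pos[of s] by simp_all
    have "(bend has_real_derivative (?r - s * (s / ?r)) / ?r\<^sup>2) (at s)"
      unfolding bend_def[abs_def] using r
      by (auto intro!: derivative_eq_intros simp: field_simps power2_eq_square)
    also have "(?r - s * (s / ?r)) / ?r\<^sup>2 = (?r\<^sup>2 - s\<^sup>2) / ?r ^ 3"
      using r(1) by (simp add: field_simps power2_eq_square power3_eq_cube)
    finally show ?thesis using r(2) by simp
  qed
  have le: "norm (1 / sqrt (1 + s\<^sup>2) ^ 3) \<le> 1" for s :: real
  proof -
    have "1 \<le> sqrt (1 + s\<^sup>2) ^ 3"
      by (rule one_le_power) simp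
    then have "1 / sqrt (1 + s\<^sup>2) ^ 3 \<le> 1 / 1"
      using sqrt_one_plus_square_pos[of s] by (intro divide_left_mono) auto
    then show ?thesis by simp
  qed
  have "norm (bend u - bend v) \<le> 1 * norm (u - v)"
    using deriv le by (intro field_differentiable_bound[of UNIV]) auto
  then show ?thesis by simp
qed

section \<open>The mixing matrix of two nodes\<close>

lemma det_dim2:
  fixes A :: "'a :: comm_ring_1 mat"
  assumes A: "A \<in> carrier_mat 2 2"
  shows "det A = A $$ (0, 0) * A $$ (1, 1) - A $$ (0, 1) * A $$ (1, 0)"
proof -
  have "det A = (\<Sum>i<2. A $$ (i, 0) * cofactor A i 0)"
    using A by (rule laplace_expansion_column) simp
  \<comment> \<open>Here \<open>1 - i\<close> is the other row, so the minor has a single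
    entry.\<close>
  moreover have "det (mat_delete A i 0) = A $$ (1 - i, 1)" if "i < 2" for i
    using A that by (subst det_single) (auto simp: mat_delete_def less_2_cases_iff)
  ultimately show ?thesis
    by (simp add: cofactor_def numeral_2_eq_2 algebra_simps)
qed

text \<open>The matrix is the orthogonal projection onto the constant vectors, so its spectrum is 1,
  0. With two nodes, the second and the last eigenvalue coincide.\<close>

lemma mixing_matrix_half:
  "mixing_matrix 2 {{0, 1}} (mat 2 2 (\<lambda>_. 1 / 2))"
proof -
  let ?W = "mat 2 2 (\<lambda>_. 1 / 2) :: real mat"
  have "char_poly ?W = (\<Prod>l\<leftarrow>[1, 0]. [:- l, 1:])"
    by (simp add: char_poly_def char_poly_matrix_def det_dim2)
  then have spectrum: "\<exists>ls. char_poly ?W = (\<Prod>l\<leftarrow>ls. [:- l, 1:]) \<and> length ls = 2 \<and>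
      sorted_wrt (\<ge>) ls \<and> ls ! 0 = 1 \<and> \<bar>ls ! 1\<bar> < 1 \<and> \<bar>ls ! (2 - 1)\<bar> < 1"
    by (intro exI[of _ "[1, 0]"]) simp
  have edge: "{i, j} = {0, 1}" if "i < 2" "j < 2" "i \<noteq> j" for i j :: nat
    using that by (auto simp: less_2_cases_iff)
  show ?thesis
    unfolding mixing_matrix_def
  proof (intro conjI spectrum)
    show "?W\<^sup>T = ?W" by (rule eq_matI) simp_all
    show "\<forall>i<2. \<forall>j<2. i \<noteq> j \<longrightarrow> {i, j} \<notin> {{0, 1}} \<longrightarrow> ?W $$ (i, j) = 0"
    proof (intro allI impI)
      fix i j :: nat
      assume "i < 2" "j < 2" "i \<noteq> j" "{i, j} \<notin> {{0, 1}}"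
      then have False using edge[of i j] by simp
      then show "?W $$ (i, j) = 0" ..
    qed
  qed simp_all
qed

section \<open>Exact gradients and runs that stand still\<close>

text \<open>A constant is its own conditional expectation. The oracle returns the true gradient, so
  the deviation is 0 and any \<open>\<sigma>\<close> bounds it.\<close>

lemma deterministic_unbiased_bounded_variance:
  assumes "prob_space M" and "\<And>t i. 1 \<le> t \<Longrightarrow> i < N \<Longrightarrow> g t i \<in> carrier_vec d"
    and "\<And>t i. 1 \<le> t \<Longrightarrow> i < N \<Longrightarrow> gradient d (f i) (x t i) = g t i"
  shows "unbiased_bounded_variance N d f M (\<lambda>t i _. g t i) (\<lambda>t i _. x t i) \<sigma>"
proof -
  interpret prob_space M by fact
  have const: "AE \<omega> in M. real_cond_exp M (past N d M (\<lambda>t i _. g t i) t) (\<lambda>_. c) \<omega> = c"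
    for t and c :: real
  proof -
    let ?F = "past N d M (\<lambda>t i _. g t i) t"
    let ?S = "{(\<lambda>_. g s i $ k) -` B \<inter> space M | s i k B.
        1 \<le> s \<and> s < t \<and> i < N \<and> k < d \<and> B \<in> sets (borel :: real measure)}"
    \<comment> \<open>The preimage of a set under a constant map is empty or the whole
      space.\<close>
    have S: "?S \<subseteq> sets M" by (auto simp: vimage_def)
    have "?S \<subseteq> Pow (space M)" by auto
    then have "sets ?F = sigma_sets (space M) ?S" "space ?F = space M"
      unfolding past_def by (rule sets_measure_of, rule space_measure_of)
    with S have "subalgebra M ?F"
      unfolding subalgebra_def using sets.sigma_sets_subset[OF S] by simp
    then interpret finite_measure_subalgebra M ?F
      by unfold_locales
    show ?thesis
      by (rule real_cond_exp_F_meas) auto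
  qed
  show ?thesis
    unfolding unbiased_bounded_variance_def
  proof (intro allI impI conjI)
    fix t i k :: nat assume *: "1 \<le> t" "i < N" "k < d"
    show "AE \<omega> in M. real_cond_exp M (past N d M (\<lambda>t i _. g t i) t) (\<lambda>\<omega>. g t i $ k) \<omega>
        = gradient d (f i) (x t i) $ k"
      using const assms(3) * by simp
    have "(g t i - gradient d (f i) (x t i)) $ k = 0"
      using assms(2)[of t i] assms(3)[of t i] * by simp
    then show "AE \<omega> in M. real_cond_exp M (past N d M (\<lambda>t i _. g t i) t)
        (\<lambda>\<omega>. ((g t i - gradient d (f i) (x t i)) $ k)\<^sup>2) \<omega> \<le> \<sigma>\<^sup>2"
      using const[of t 0] by (auto elim!: eventually_mono)
  qed
qed

text \<open>With all three decay rates 0, \<open>m\<close> is the current gradient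
  \<open>D i\<close>, and \<open>vhat\<close> is its square because \<open>\<epsilon>\<close> lies
  below that square. The update is then averaging followed by a step of length
  \<open>\<alpha>\<close> against the sign of \<open>D i\<close>; \<open>mix\<close> says that
  \<open>p\<close> is a fixed point of it.\<close>

lemma dadam_steady:
  assumes mix: "\<And>i. i < N \<Longrightarrow>
      (\<Sum>j<N. W $$ (i, j) * p j) - \<alpha> * D i / sqrt ((D i)\<^sup>2) = p i"
    and eps: "\<And>i. i < N \<Longrightarrow> \<epsilon> \<le> (D i)\<^sup>2"
    and i: "i < N"
  shows "dadam_x N 1 W \<alpha> 0 0 0 \<epsilon> (\<lambda>i. vec 1 (\<lambda>_. p i)) (\<lambda>_ j. vec 1 (\<lambda>_. D j)) t i
    = vec 1 (\<lambda>_. p i)"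
proof -
  let ?g = "\<lambda>(_::nat) j. vec 1 (\<lambda>_. D j)"
  have m: "dadam_m 1 0 ?g (Suc t) i = vec 1 (\<lambda>_. D i)" for t i
    by (rule eq_vecI) auto
  have v: "dadam_v 1 0 ?g (Suc t) i = vec 1 (\<lambda>_. (D i)\<^sup>2)" for t i
    by (rule eq_vecI) auto
  have vhat: "dadam_vhat 1 0 0 \<epsilon> ?g (Suc t) i = vec 1 (\<lambda>_. (D i)\<^sup>2)" if "i < N" for t i
  proof (induction t)
    case 0
    show ?case by (rule eq_vecI) (use eps[OF that] in auto)
  next
    case (Suc t)
    show ?case
      unfolding dadam_vhat.simps(2)[of _ _ _ _ _ "Suc t"] Suc v by (rule eq_vecI) auto
  qed
  \<comment> \<open>The induction treats all nodes at once, since averaging reads the points of the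
    others. It starts at iteration 1; the dummy value at 0 is the initial point as well.\<close>
  have "\<forall>i<N. dadam_x N 1 W \<alpha> 0 0 0 \<epsilon> (\<lambda>i. vec 1 (\<lambda>_. p i)) ?g (Suc t) i = vec 1 (\<lambda>_. p i)"
    for t
  proof (induction t)
    case 0
    show ?case by simp
  next
    case (Suc t)
    have "(\<Sum>j<N. W $$ (i, j) *
        dadam_x N 1 W \<alpha> 0 0 0 \<epsilon> (\<lambda>i. vec 1 (\<lambda>_. p i)) ?g (Suc t) j $ 0) = (\<Sum>j<N. W $$ (i, j) * p j)"
      for i
      using Suc by (intro sum.cong) auto
    then show ?case
      using mix by (auto simp: m vhat simp del: dadam_m.simps dadam_vhat.simps One_nat_def intro!: eq_vecI)
  qed
  then show ?thesis using i by (cases t) auto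
qed

section \<open>The two-node example\<close>

theorem theorem1:
  shows "\<exists>(N::nat) (d::nat) (f :: nat \<Rightarrow> real vec \<Rightarrow> real)
           (M :: (nat \<Rightarrow> nat \<Rightarrow> nat \<Rightarrow> real) measure)
           (g :: nat \<Rightarrow> nat \<Rightarrow> (nat \<Rightarrow> nat \<Rightarrow> nat \<Rightarrow> real) \<Rightarrow> real vec)
           (E :: nat set set) (W :: real mat) (x1 :: nat \<Rightarrow> real vec)
           (\<alpha>::real) (\<beta>1::real) (\<beta>2::real) (\<beta>3::real) (\<epsilon>::real)
           (L::real) (G::real) (\<sigma>::real).
     2 \<le> N \<and> 1 \<le> d \<and>
     0 < \<alpha> \<and> \<beta>1 \<in> {0..<1} \<and> \<beta>2 \<in> {0..<1} \<and> \<beta>3 \<in> {0..<1} \<and> 0 < \<epsilon> \<and>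
     (\<forall>i<N. x1 i \<in> carrier_vec d) \<and>
     gradient_oracle N d M g \<and>
     communication_graph N E \<and>
     (let x = (\<lambda>t i \<omega>. dadam_x N d W \<alpha> \<beta>1 \<beta>2 \<beta>3 \<epsilon> x1 (\<lambda>s j. g s j \<omega>) t i) in
        smooth_objectives N d f L \<and>
        bounded_gradients N d f M g G \<and>
        unbiased_bounded_variance N d f M g x \<sigma> \<and>
        mixing_matrix N E W \<and>
        (AE \<omega> in M. \<not> (\<lambda>t. norm2 (gradient d (average_objective N f)
             (average_point N d (\<lambda>i. x t i \<omega>)))) \<longlonglongrightarrow> 0))"
proof -
  \<comment> \<open>Each node starts at distance 1 from 0 and from its minimiser \<open>a i\<close>,
    on the segment between them. After averaging to 0, a unit step towards \<open>a i\<close> leads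
    back to \<open>p i\<close>.\<close>
  define c :: "nat \<Rightarrow> real" where "c i = (if i = 0 then 1 else 3)" for i
  define a :: "nat \<Rightarrow> real" where "a i = (if i = 0 then 2 else - 2)" for i
  define p :: "nat \<Rightarrow> real" where "p i = (if i = 0 then 1 else - 1)" for i
  define f :: "nat \<Rightarrow> real vec \<Rightarrow> real"
    where "f i y = c i * sqrt (1 + (y $ 0 - a i)\<^sup>2)" for i y
  \<comment> \<open>The gradients are fixed in advance as those at the initial points. That they are
    the gradients along the run is known only once the run is shown to stand still.\<close>
  define D where "D i = c i * bend (p i - a i)" for i
  define g :: "nat \<Rightarrow> nat \<Rightarrow> real vec" where "g t i = vec 1 (\<lambda>_. D i)" for t i
  \<comment> \<open>A point mass at an arbitrary point: the oracle is deterministic.\<close>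
  define M :: "(nat \<Rightarrow> nat \<Rightarrow> nat \<Rightarrow> real) measure"
    where "M = return (count_space UNIV) undefined"
  define W :: "real mat" where "W = mat 2 2 (\<lambda>_. 1 / 2)"
  define x1 :: "nat \<Rightarrow> real vec" where "x1 i = vec 1 (\<lambda>_. p i)" for i
  define x where "x t i = dadam_x 2 1 W 1 0 0 0 (1 / 4) x1 g t i" for t i

  have M: "prob_space M"
    unfolding M_def by (rule prob_space_return) simp
  \<comment> \<open>As \<open>bend\<close> is 1-Lipschitz and bounded by 1, the larger weight 3
    serves both as Lipschitz constant and as gradient bound.\<close>
  have c: "\<bar>c i\<bar> \<le> 3" for i by (simp add: c_def)
  have grad: "gradient 1 (f i) y = vec 1 (\<lambda>_. c i * bend (y $ 0 - a i))"
    if "y \<in> carrier_vec 1" for i y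
    unfolding f_def[abs_def] by (rule gradient_dim1[OF that DERIV_sqrt_one_plus_square])

  have D: "D i = (if i = 0 then - 1 / sqrt 2 else 3 / sqrt 2)" for i
    by (simp add: D_def c_def a_def p_def bend_def)
  \<comment> \<open>The squares of \<open>D 0\<close> and \<open>D 1\<close> are 1/2 and 9/2, so
    \<open>\<epsilon>\<close> = 1/4 is small enough.\<close>
  have x: "x t i = vec 1 (\<lambda>_. p i)" if "i < 2" for t i
    unfolding x_def x1_def[abs_def] g_def[abs_def] using that
    by (intro dadam_steady)
      (auto simp: D W_def p_def numeral_2_eq_2 power_divide real_sqrt_divide field_simps split: if_splits)

  have smooth: "smooth_objectives 2 1 f 3"
    unfolding smooth_objectives_def
  proof (intro allI impI conjI ballI)
    fix i :: nat and y :: "real vec" assume "y \<in> carrier_vec 1"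
    then show "\<exists>v. has_gradient 1 (f i) v y"
      unfolding f_def[abs_def]
      by (intro exI[of _ "vec 1 (\<lambda>_. c i * bend (y $ 0 - a i))"] has_gradient_dim1_iff[THEN iffD2])
        (simp_all add: DERIV_sqrt_one_plus_square)
  next
    fix i :: nat and y z :: "real vec" assume yz: "y \<in> carrier_vec 1" "z \<in> carrier_vec 1"
    have "\<bar>c i * bend (y $ 0 - a i) - c i * bend (z $ 0 - a i)\<bar>
        = \<bar>c i\<bar> * \<bar>bend (y $ 0 - a i) - bend (z $ 0 - a i)\<bar>"
      by (simp add: abs_mult flip: right_diff_distrib)
    also have "\<dots> \<le> 3 * \<bar>y $ 0 - z $ 0\<bar>"
      using c bend_Lipschitz[of "y $ 0 - a i" "z $ 0 - a i"] by (intro mult_mono) auto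
    finally show "norm2 (gradient 1 (f i) y - gradient 1 (f i) z) \<le> 3 * norm2 (y - z)"
      using yz by (simp add: grad norm2_dim1 del: One_nat_def)
  qed

  have le3: "\<bar>c i * bend u\<bar> \<le> 3" for i u
    using mult_mono[OF c[of i] abs_bend_le[of u]] by (simp add: abs_mult)
  then have bounded: "bounded_gradients 2 1 f M (\<lambda>t i _. g t i) 3"
    by (simp add: bounded_gradients_def g_def D_def grad norm_inf_dim1 del: One_nat_def)

  have random_gradients: "gradient_oracle 2 1 M (\<lambda>t i _. g t i)"
    using M by (simp add: gradient_oracle_def g_def)

  have unbiased: "unbiased_bounded_variance 2 1 f M (\<lambda>t i _. g t i) (\<lambda>t i _. x t i) 0"
    using M by (intro deterministic_unbiased_bounded_variance) (auto simp: x grad g_def D_def simp del: One_nat_def)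

  have mean: "average_point 2 1 (x t) = vec 1 (\<lambda>_. 0)" for t
    by (rule eq_vecI) (auto simp: average_point_def x p_def numeral_2_eq_2)
  have "((\<lambda>s. (\<Sum>i<2. c i * sqrt (1 + (s - a i)\<^sup>2)) / real 2)
      has_real_derivative (\<Sum>i<2. c i * bend (0 - a i)) / real 2) (at 0)"
    by (intro DERIV_cdivide DERIV_sum DERIV_sqrt_one_plus_square)
  then have "gradient 1 (average_objective 2 f) (vec 1 (\<lambda>_. 0))
      = vec 1 (\<lambda>_. (\<Sum>i<2. c i * bend (0 - a i)) / real 2)"
    using gradient_dim1[of "vec 1 (\<lambda>_. 0)" "\<lambda>s. (\<Sum>i<2. c i * sqrt (1 + (s - a i)\<^sup>2)) / real 2"]
    by (simp add: average_objective_def[abs_def] f_def del: One_nat_def)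
  \<comment> \<open>The values of \<open>bend\<close> at -2 and 2 are opposite, so only the
    difference 3 - 1 of the weights survives.\<close>
  also have "(\<Sum>i<2. c i * bend (0 - a i)) / real 2 = 2 / sqrt 5"
    by (simp add: numeral_2_eq_2 c_def a_def bend_def)
  finally have "norm2 (gradient 1 (average_objective 2 f) (average_point 2 1 (x t))) = 2 / sqrt 5"
    for t by (simp add: mean norm2_dim1 del: One_nat_def)
  then have limit: "\<not> (\<lambda>t. norm2 (gradient 1 (average_objective 2 f)
      (average_point 2 1 (\<lambda>i. x t i)))) \<longlonglongrightarrow> 0"
    by (simp add: LIMSEQ_const_iff)

  have "(\<forall>i<2. x1 i \<in> carrier_vec 1) \<and> communication_graph 2 {{0, 1}}"
    by (simp add: x1_def communication_graph_def)
  note facts = this smooth bounded random_gradients unbiased limit mixing_matrix_half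
  show ?thesis
    unfolding Let_def
    \<comment> \<open>After \<open>x1\<close> the witnesses are \<open>\<alpha>\<close> = 1, the
      three decay rates 0, \<open>\<epsilon>\<close> = 1/4, \<open>L\<close> = \<open>G\<close> = 3
      and \<open>\<sigma>\<close> = 0.\<close>
    by (rule exI[of _ 2], rule exI[of _ 1], rule exI[of _ f], rule exI[of _ M],
        rule exI[of _ "\<lambda>t i _. g t i"], rule exI[of _ "{{0, 1}}"], rule exI[of _ W],
        rule exI[of _ x1], rule exI[of _ 1], rule exI[of _ 0], rule exI[of _ 0],
        rule exI[of _ 0], rule exI[of _ "1 / 4"], rule exI[of _ 3], rule exI[of _ 3],
        rule exI[of _ 0])
      (use facts[unfolded x_def] in \<open>simp add: W_def del: One_nat_def\<close>)
qed

end
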